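(* Let $n\ge 1$, let $N$ be an $n$-dimensional $C^\infty$ manifold without boundary, let $(\widetilde f,\widetilde\nu): N\to\mathbb{R}^{n+1}\times S^n$ be a frontal, and let $P\in\mathbb{R}^{n+1}$ be a point such that $(\widetilde f(x)-P)\cdot\widetilde\nu(x)\neq 0$ for every $x\in N$. Then the orthotomic of $\widetilde f$ relative to $P$, defined by $$f(x)=2\left((\widetilde f(x)-P)\cdot\widetilde\nu(x)\right)\widetilde\nu(x)+P,$$ is a frontal with Gauss mapping $\nu(x)=\frac{f(x)-\widetilde f(x)}{\|f(x)-\widetilde f(x)\|}$. Moreover, $(f(x)-P)\cdot\nu(x)\neq 0$ holds for every $x\in N$.
   Context: All mappings are of class $C^\infty$. $S^n\subset\mathbb{R}^{n+1}$ is the unit sphere, $\cdot$ is the Euclidean scalar product, and $T_{y}\mathbb{R}^{n+1}$ is identified with $\mathbb{R}^{n+1}$. A mapping $f:N\to\mathbb{R}^{n+1}$ is a frontal if there is a mapping $\nu:N\to S^n$ (called its Gauss mapping) with $df_x(\mathbf v)\cdot\nu(x)=0$ for all $x\in N$, $\mathbf v\in T_xN$; the pair $(f,\nu)$ is also called a frontal. *)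

theory Defs
  imports "HOL-Analysis.Analysis"
begin

text \<open>The predicates \<open>Ck_on\<close> and \<open>smooth_on\<close> are meant for open sets \<open>S\<close>: derivatives are taken
  with respect to full neighbourhoods.  On such sets \<open>Ck_on k f S\<close> is the usual class \<open>C\<^sup>k\<close>: the
  directional derivatives of a differentiable map along all fixed vectors being of class \<open>C\<^sup>k\<close>
  means that the derivative itself is, the dimension of the domain being finite.\<close>

primrec Ck_on :: "nat \<Rightarrow> ('a::euclidean_space \<Rightarrow> 'b::real_normed_vector) \<Rightarrow> 'a set \<Rightarrow> bool" where
  "Ck_on 0 f S \<longleftrightarrow> continuous_on S f"
| "Ck_on (Suc k) f S \<longleftrightarrow>
     (\<forall>x\<in>S. f differentiable (at x)) \<and> (\<forall>v. Ck_on k (\<lambda>x. frechet_derivative f (at x) v) S)"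

definition smooth_on :: "('a::euclidean_space \<Rightarrow> 'b::real_normed_vector) \<Rightarrow> 'a set \<Rightarrow> bool" where
  "smooth_on f S \<longleftrightarrow> (\<forall>k. Ck_on k f S)"

text \<open>A manifold is given by a topology \<open>N\<close>, whose points are \<open>topspace N\<close>, and a smooth atlas \<open>A\<close>
  (not necessarily maximal) of charts \<open>(U, \<phi>)\<close>; its dimension is \<open>CARD('n)\<close>, hence at least 1.
  Charts map onto open subsets of the model space, so there is no boundary.  Values of a chart
  \<open>\<phi>\<close> outside \<open>U\<close>, and of a map on \<open>N\<close> outside \<open>topspace N\<close>, are irrelevant.\<close>

definition smooth_manifold :: "'p topology \<Rightarrow> ('p set \<times> ('p \<Rightarrow> real ^ 'n)) set \<Rightarrow> bool" where
  "smooth_manifold N A \<longleftrightarrow>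
     Hausdorff_space N \<and> second_countable N \<and>
     (\<Union>(U, \<phi>)\<in>A. U) = topspace N \<and>
     (\<forall>(U, \<phi>)\<in>A. openin N U \<and> open (\<phi> ` U) \<and>
        homeomorphic_map (subtopology N U) (top_of_set (\<phi> ` U)) \<phi>) \<and>
     (\<forall>(U, \<phi>)\<in>A. \<forall>(V, \<psi>)\<in>A. smooth_on (\<psi> \<circ> inv_into U \<phi>) (\<phi> ` (U \<inter> V)))"

definition smooth_map ::
    "('p set \<times> ('p \<Rightarrow> real ^ 'n)) set \<Rightarrow> ('p \<Rightarrow> 'b::real_normed_vector) \<Rightarrow> bool" where
  "smooth_map A f \<longleftrightarrow> (\<forall>(U, \<phi>)\<in>A. smooth_on (f \<circ> inv_into U \<phi>) (\<phi> ` U))"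

text \<open>Tangent vectors at \<open>x\<close> are the derivations at \<open>x\<close> of the algebra of smooth real functions.
  As HOL functions are total, a derivation is set to 0 on functions that are not smooth.  The
  Leibniz rule already makes its value independent of the values of \<open>g\<close> outside the manifold.\<close>

definition tangent_space ::
    "('p set \<times> ('p \<Rightarrow> real ^ 'n)) set \<Rightarrow> 'p \<Rightarrow> (('p \<Rightarrow> real) \<Rightarrow> real) set" where
  "tangent_space A x = {v.
     (\<forall>g. \<not> smooth_map A g \<longrightarrow> v g = 0) \<and>
     (\<forall>g h. smooth_map A g \<longrightarrow> smooth_map A h \<longrightarrow> v (\<lambda>y. g y + h y) = v g + v h) \<and>
     (\<forall>c g. smooth_map A g \<longrightarrow> v (\<lambda>y. c * g y) = c * v g) \<and>
     (\<forall>g h. smooth_map A g \<longrightarrow> smooth_map A h \<longrightarrow> v (\<lambda>y. g y * h y) = g x * v h + h x * v g)}"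

text \<open>The differential of \<open>f\<close> sends a tangent vector \<open>v\<close> at \<open>x\<close> to the derivation
  \<open>h \<mapsto> v (h \<circ> f)\<close> at \<open>f x\<close>, which is identified with the vector of its values on the
  coordinate functions.  The base point \<open>x\<close> is implicit in \<open>v\<close>.\<close>

definition differential :: "('p \<Rightarrow> real ^ 'm) \<Rightarrow> (('p \<Rightarrow> real) \<Rightarrow> real) \<Rightarrow> real ^ 'm" where
  "differential f v = (\<chi> i. v (\<lambda>y. f y $ i))"

text \<open>\<open>frontal N A f \<nu>\<close>: the map \<open>f\<close> is a frontal with Gauss mapping \<open>\<nu>\<close>.  Smoothness of \<open>\<nu>\<close> as a
  map into the embedded submanifold \<open>sphere 0 1\<close> is smoothness as a map into the ambient space.\<close>

definition frontal :: "'p topology \<Rightarrow> ('p set \<times> ('p \<Rightarrow> real ^ 'n)) set \<Rightarrow>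
    ('p \<Rightarrow> real ^ 'm) \<Rightarrow> ('p \<Rightarrow> real ^ 'm) \<Rightarrow> bool" where
  "frontal N A f \<nu> \<longleftrightarrow>
     smooth_map A f \<and> smooth_map A \<nu> \<and>
     (\<forall>x\<in>topspace N. \<nu> x \<in> sphere 0 1) \<and>
     (\<forall>x\<in>topspace N. \<forall>v\<in>tangent_space A x. differential f v \<bullet> \<nu> x = 0)"

definition orthotomic ::
    "real ^ 'm \<Rightarrow> ('p \<Rightarrow> real ^ 'm) \<Rightarrow> ('p \<Rightarrow> real ^ 'm) \<Rightarrow> 'p \<Rightarrow> real ^ 'm" where
  "orthotomic P f \<nu> x = (2 * ((f x - P) \<bullet> \<nu> x)) *\<^sub>R \<nu> x + P"

end

theory Submission
  imports Defs
begin

text \<open>Write \<open>g = ft - P\<close>, \<open>h = 2 (g \<bullet> nut)\<close> and \<open>w = f - ft = h nut - g\<close>, the reflection of \<open>-g\<close> in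
  the hyperplane orthogonal to \<open>nut\<close>.  Hence \<open>norm w = norm g > 0\<close>, and \<open>(f - P) \<bullet> w = h\<^sup>2 / 2 \<noteq> 0\<close>.
  Since \<open>dg \<bullet> nut = 0\<close> and \<open>dnut \<bullet> nut = 0\<close>, one has \<open>dh = 2 (g \<bullet> dnut)\<close> and therefore
  \<open>df \<bullet> w = (dh nut + h dnut) \<bullet> (h nut - g) = h dh / 2 - h (g \<bullet> dnut) = 0\<close>.\<close>

section \<open>Calculus of \<open>Ck_on\<close> on open sets\<close>

text \<open>On an open set the derivative at a point sees only values inside the set, so agreement
  passes from the maps to their directional derivatives, and induction applies.\<close>

lemma Ck_on_cong:
  assumes "open S" and "\<And>x. x \<in> S \<Longrightarrow> f x = g x"
  shows "Ck_on k f S \<longleftrightarrow> Ck_on k g S"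
proof -
  have "Ck_on k g S" if "Ck_on k f S" "\<And>x. x \<in> S \<Longrightarrow> f x = g x" for f g
    using that
  proof (induction k arbitrary: f g)
    case 0
    then show ?case by (metis Ck_on.simps(1) continuous_on_cong)
  next
    case (Suc k)
    have der: "(g has_derivative frechet_derivative f (at x)) (at x)" if "x \<in> S" for x
      by (rule has_derivative_transform_within_open[OF _ assms(1) that Suc.prems(2)])
        (use Suc.prems(1) that in \<open>simp_all add: frechet_derivative_works\<close>)
    have "Ck_on k (\<lambda>x. frechet_derivative g (at x) v) S" for v
      using Suc.prems(1) frechet_derivative_at[OF der]
      by (intro Suc.IH[of "\<lambda>x. frechet_derivative f (at x) v"
            "\<lambda>x. frechet_derivative g (at x) v"]) simp_all
    with der show ?case by (auto simp: differentiable_def)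
  qed
  with assms(2) show ?thesis by metis
qed

text \<open>Derivatives at a point are unique, so any explicit formula \<open>f'\<close> may replace
  \<open>frechet_derivative\<close>. The two agree only on \<open>S\<close>, hence the appeal to
  \<open>Ck_on_cong\<close>.\<close>

lemma Ck_on_SucI:
  assumes "open S"
    and der: "\<And>x. x \<in> S \<Longrightarrow> (f has_derivative f' x) (at x)"
    and "\<And>v. Ck_on k (\<lambda>x. f' x v) S"
  shows "Ck_on (Suc k) f S"
proof -
  have "Ck_on k (\<lambda>x. frechet_derivative f (at x) v) S" for v
    using Ck_on_cong[OF assms(1), of "\<lambda>x. f' x v" "\<lambda>x. frechet_derivative f (at x) v" k]
      assms(3) frechet_derivative_at[OF der] by simp
  with der show ?thesis by (auto simp: differentiable_def)
qed

text \<open>The successor clause of \<open>Ck_on\<close> says nothing about \<open>f\<close> at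
  level \<open>k\<close>. Differentiability gives continuity at the base; the step passes to
  directional derivatives.\<close>

lemma Ck_on_Suc_imp:
  "Ck_on (Suc k) f S \<Longrightarrow> Ck_on k f S"
proof (induction k arbitrary: f)
  case 0
  then show ?case
    by (auto intro!: continuous_at_imp_continuous_on differentiable_imp_continuous_within)
next
  case (Suc k)
  have "Ck_on k (\<lambda>x. frechet_derivative f (at x) v) S" for v
    using Suc.prems by (intro Suc.IH) simp
  with Suc.prems show ?case by simp
qed

lemma Ck_on_const: "Ck_on k (\<lambda>x. c) S"
  by (induction k arbitrary: c) simp_all

lemma Ck_on_add:
  assumes "open S" "Ck_on k f S" "Ck_on k g S"
  shows "Ck_on k (\<lambda>x. f x + g x) S"
  using assms(2,3)
proof (induction k arbitrary: f g)
  case 0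
  then show ?case by (simp add: continuous_on_add)
next
  case (Suc k)
  show ?case
  proof (rule Ck_on_SucI[OF assms(1)])
    show "((\<lambda>x. f x + g x) has_derivative
        (\<lambda>h. frechet_derivative f (at x) h + frechet_derivative g (at x) h)) (at x)"
      if "x \<in> S" for x
      using Suc.prems that by (intro has_derivative_add) (auto simp: frechet_derivative_works)
    show "Ck_on k (\<lambda>x. frechet_derivative f (at x) v + frechet_derivative g (at x) v) S" for v
      using Suc.prems by (intro Suc.IH) auto
  qed
qed

text \<open>The product rule gives two terms of the same bilinear form, each pairing a derivative
  with an undifferentiated factor; the latter is lowered to class \<open>k\<close> first. Products,
  scalar multiples and inner products are all instances.\<close>

lemma Ck_on_bilinear:
  assumes b: "bounded_bilinear b" and S: "open S" and "Ck_on k f S" "Ck_on k g S"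
  shows "Ck_on k (\<lambda>x. b (f x) (g x)) S"
  using assms(3,4)
proof (induction k arbitrary: f g)
  case 0
  then show ?case by (simp add: bounded_bilinear.continuous_on[OF b])
next
  case (Suc k)
  have low: "Ck_on k f S" "Ck_on k g S"
    using Suc.prems Ck_on_Suc_imp by blast+
  show ?case
  proof (rule Ck_on_SucI[OF S])
    show "((\<lambda>x. b (f x) (g x)) has_derivative
        (\<lambda>h. b (f x) (frechet_derivative g (at x) h) + b (frechet_derivative f (at x) h) (g x))) (at x)"
      if "x \<in> S" for x
      using Suc.prems that by (intro bounded_bilinear.FDERIV[OF b]) (auto simp: frechet_derivative_works)
    show "Ck_on k (\<lambda>x. b (f x) (frechet_derivative g (at x) v)
        + b (frechet_derivative f (at x) v) (g x)) S" for v
      using Suc.prems low by (intro Ck_on_add[OF S] Suc.IH) auto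
  qed
qed

text \<open>Differentiation lowers the exponent by one, so the induction must run over all real
  \<open>a\<close> at once.\<close>

lemma Ck_on_powr:
  fixes r :: "'a::euclidean_space \<Rightarrow> real"
  assumes "open S" "Ck_on k r S" and pos: "\<And>x. x \<in> S \<Longrightarrow> r x > 0"
  shows "Ck_on k (\<lambda>x. r x powr a) S"
  using assms(2)
proof (induction k arbitrary: a)
  case 0
  then show ?case using pos by (fastforce intro!: continuous_on_powr)
next
  case (Suc k)
  have low: "Ck_on k r S" using Suc.prems Ck_on_Suc_imp by blast
  show ?case
  proof (rule Ck_on_SucI[OF assms(1)])
    show "((\<lambda>x. r x powr a) has_derivative
        (\<lambda>h. (a * r x powr (a - 1)) * frechet_derivative r (at x) h)) (at x)" if "x \<in> S" for x
    proof -
      have r: "(r has_derivative frechet_derivative r (at x)) (at x)"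
        using Suc.prems that by (simp add: frechet_derivative_works)
      have "((\<lambda>t. t powr a) has_derivative (\<lambda>h. (a * r x powr (a - 1)) * h)) (at (r x))"
        using has_real_derivative_powr[OF pos[OF that]]
        by (simp add: has_field_derivative_def)
      from has_derivative_compose[OF r this] show ?thesis .
    qed
    show "Ck_on k (\<lambda>x. (a * r x powr (a - 1)) * frechet_derivative r (at x) v) S" for v
      using Suc.prems low
      by (intro Ck_on_bilinear[OF bounded_bilinear_mult assms(1)] Suc.IH Ck_on_const) auto
  qed
qed

section \<open>Smooth maps on a manifold\<close>

context
  fixes N :: "'p topology" and A :: "('p set \<times> ('p \<Rightarrow> real ^ 'n)) set"
  assumes manifold: "smooth_manifold N A"
begin

lemma smooth_map_iff:
  "smooth_map A F \<longleftrightarrow> (\<forall>(U, \<phi>)\<in>A. \<forall>k. Ck_on k (\<lambda>y. F (inv_into U \<phi> y)) (\<phi> ` U))"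
  by (simp add: smooth_map_def smooth_on_def comp_def)

lemma open_chart: "(U, \<phi>) \<in> A \<Longrightarrow> open (\<phi> ` U)"
  using manifold by (auto simp: smooth_manifold_def)

lemma inv_chart_in: "(U, \<phi>) \<in> A \<Longrightarrow> y \<in> \<phi> ` U \<Longrightarrow> inv_into U \<phi> y \<in> topspace N"
  using manifold inv_into_into[of y \<phi> U] by (auto simp: smooth_manifold_def)

text \<open>Inverse charts take values in \<open>topspace N\<close>, so values elsewhere never
  matter. This is what makes the indicator of the complement smooth in
  \<open>tangent_cong\<close>.\<close>

lemma smooth_map_cong:
  assumes "\<And>x. x \<in> topspace N \<Longrightarrow> F x = G x"
  shows "smooth_map A F \<longleftrightarrow> smooth_map A G"
proof -
  have "Ck_on k (\<lambda>y. F (inv_into U \<phi> y)) (\<phi> ` U) \<longleftrightarrow> Ck_on k (\<lambda>y. G (inv_into U \<phi> y)) (\<phi> ` U)"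
    if "(U, \<phi>) \<in> A" for U \<phi> k
    using that assms inv_chart_in open_chart by (intro Ck_on_cong) blast+
  then show ?thesis unfolding smooth_map_iff by auto
qed

lemma smooth_map_const: "smooth_map A (\<lambda>x. c)"
  by (auto simp: smooth_map_iff Ck_on_const)

lemma smooth_map_add:
  "smooth_map A F \<Longrightarrow> smooth_map A G \<Longrightarrow> smooth_map A (\<lambda>x. F x + G x)"
  unfolding smooth_map_iff by (fast intro: Ck_on_add open_chart)

lemma smooth_map_bilinear:
  assumes "bounded_bilinear b" "smooth_map A F" "smooth_map A G"
  shows "smooth_map A (\<lambda>x. b (F x) (G x))"
  using assms(2,3) unfolding smooth_map_iff
  by (fast intro: Ck_on_bilinear[OF assms(1)] open_chart)

lemmas smooth_map_mult = smooth_map_bilinear[OF bounded_bilinear_mult]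
  and smooth_map_scaleR = smooth_map_bilinear[OF bounded_bilinear_scaleR]
  and smooth_map_inner = smooth_map_bilinear[OF bounded_bilinear_inner]

lemma smooth_map_diff:
  assumes "smooth_map A F" "smooth_map A G"
  shows "smooth_map A (\<lambda>x. F x - G x)"
  using smooth_map_add[OF assms(1) smooth_map_scaleR[OF smooth_map_const[of "-1"] assms(2)]]
  by simp

lemma smooth_map_nth:
  fixes F :: "'p \<Rightarrow> real ^ 'm"
  assumes "smooth_map A F"
  shows "smooth_map A (\<lambda>x. F x $ i)"
  using smooth_map_inner[OF assms smooth_map_const[of "axis i 1"]] by (simp add: inner_axis)

lemma smooth_map_sum:
  assumes "\<And>i. i \<in> I \<Longrightarrow> smooth_map A (F i)"
  shows "smooth_map A (\<lambda>x. \<Sum>i\<in>I. F i x)"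
  using assms by (induction I rule: infinite_finite_induct)
    (simp_all add: smooth_map_const smooth_map_add)

text \<open>The factor \<open>1 / norm (F x)\<close> equals
  \<open>(F x \<bullet> F x) powr (- (1/2))\<close>, a real power of a positive smooth
  function.\<close>

lemma smooth_map_normalize:
  fixes F :: "'p \<Rightarrow> 'b::real_inner"
  assumes F: "smooth_map A F" and "\<And>x. x \<in> topspace N \<Longrightarrow> F x \<noteq> 0"
  shows "smooth_map A (\<lambda>x. F x /\<^sub>R norm (F x))"
proof -
  have "smooth_map A (\<lambda>x. (F x \<bullet> F x) powr (- (1/2)))"
    unfolding smooth_map_iff
  proof clarify
    fix U \<phi> k
    assume chart: "(U, \<phi>) \<in> A"
    then have "Ck_on k (\<lambda>y. F (inv_into U \<phi> y) \<bullet> F (inv_into U \<phi> y)) (\<phi> ` U)"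
      using smooth_map_inner[OF F F] unfolding smooth_map_iff by blast
    then show "Ck_on k (\<lambda>y. (F (inv_into U \<phi> y) \<bullet> F (inv_into U \<phi> y)) powr (- (1/2))) (\<phi> ` U)"
      by (rule Ck_on_powr[OF open_chart[OF chart]])
        (use assms(2)[OF inv_chart_in[OF chart]] in \<open>simp add: inner_gt_zero_iff\<close>)
  qed
  from smooth_map_scaleR[OF this F] show ?thesis
    by (simp add: powr_minus powr_half_sqrt norm_eq_sqrt_inner)
qed

section \<open>Tangent vectors as derivations\<close>

context
  fixes x v
  assumes x: "x \<in> topspace N" and v: "v \<in> tangent_space A x"
begin

lemma tangent_add:
  "smooth_map A g \<Longrightarrow> smooth_map A h \<Longrightarrow> v (\<lambda>y. g y + h y) = v g + v h"
  using v by (simp add: tangent_space_def)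

lemma tangent_scale: "smooth_map A g \<Longrightarrow> v (\<lambda>y. c * g y) = c * v g"
  using v by (simp add: tangent_space_def)

lemma tangent_mult:
  "smooth_map A g \<Longrightarrow> smooth_map A h \<Longrightarrow> v (\<lambda>y. g y * h y) = g x * v h + h x * v g"
  using v by (simp add: tangent_space_def)

text \<open>The Leibniz rule for \<open>1 * 1\<close> reads \<open>v 1 = v 1 + v 1\<close>, so
  \<open>v\<close> kills 1 and, by scaling, every constant.\<close>

lemma tangent_const: "v (\<lambda>y. c) = 0"
  using tangent_mult[OF smooth_map_const[of 1] smooth_map_const[of 1]]
    tangent_scale[OF smooth_map_const[of 1], of c] by simp

lemma tangent_diff:
  assumes "smooth_map A g" "smooth_map A h"
  shows "v (\<lambda>y. g y - h y) = v g - v h"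
  using tangent_add[OF assms(1) smooth_map_mult[OF smooth_map_const[of "-1"] assms(2)]]
    tangent_scale[OF assms(2), of "-1"] by simp

text \<open>A function vanishing on \<open>topspace N\<close> is its own product with the indicator of the complement, and
  both factors vanish at \<open>x\<close>.\<close>

lemma tangent_cong:
  assumes g: "smooth_map A g" and h: "smooth_map A h"
    and eq: "\<And>y. y \<in> topspace N \<Longrightarrow> g y = h y"
  shows "v g = v h"
proof -
  let ?e = "\<lambda>y. if y \<in> topspace N then 0 else 1 :: real"
  have e: "smooth_map A ?e"
    using smooth_map_cong[of ?e "\<lambda>y. 0"] smooth_map_const by simp
  have "v (\<lambda>y. ?e y * (g y - h y)) = 0"
    using tangent_mult[OF e smooth_map_diff[OF g h]] x eq by simp
  moreover have "(\<lambda>y. ?e y * (g y - h y)) = (\<lambda>y. g y - h y)"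
    using eq by auto
  ultimately show ?thesis using tangent_diff[OF g h] by simp
qed

lemma tangent_sum:
  assumes "\<And>i. i \<in> I \<Longrightarrow> smooth_map A (g i)"
  shows "v (\<lambda>y. \<Sum>i\<in>I. g i y) = (\<Sum>i\<in>I. v (g i))"
  \<comment> \<open>For empty or infinite \<open>I\<close> both sums are 0 by convention, and
    \<open>tangent_const\<close> applies.\<close>
  using assms by (induction I rule: infinite_finite_induct)
    (simp_all add: tangent_const tangent_add smooth_map_sum)

text \<open>This is the scalar Leibniz rule summed over coordinates; it yields both
  \<open>dnut \<bullet> nut = 0\<close> and the formula for \<open>dh\<close>.\<close>

lemma tangent_inner:
  fixes F G :: "'p \<Rightarrow> real ^ 'm"
  assumes "smooth_map A F" "smooth_map A G"
  shows "v (\<lambda>y. F y \<bullet> G y) = F x \<bullet> differential G v + differential F v \<bullet> G x"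
proof -
  have nth: "smooth_map A (\<lambda>y. F y $ i)" "smooth_map A (\<lambda>y. G y $ i)" for i
    using assms smooth_map_nth by blast+
  have "v (\<lambda>y. F y \<bullet> G y) = (\<Sum>i\<in>UNIV. v (\<lambda>y. F y $ i * G y $ i))"
    by (simp add: inner_vec_def tangent_sum smooth_map_mult nth)
  also have "\<dots> = F x \<bullet> differential G v + differential F v \<bullet> G x"
    by (simp add: tangent_mult nth inner_vec_def differential_def sum.distrib mult.commute)
  finally show ?thesis .
qed

lemma differential_add_const:
  fixes F :: "'p \<Rightarrow> real ^ 'm"
  assumes "smooth_map A F"
  shows "differential (\<lambda>y. F y + c) v = differential F v"
  using assms
  by (simp add: differential_def vec_eq_iff tangent_add tangent_const smooth_map_nth
      smooth_map_const)

lemma differential_scaleR: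
  fixes F :: "'p \<Rightarrow> real ^ 'm"
  assumes "smooth_map A g" "smooth_map A F"
  shows "differential (\<lambda>y. g y *\<^sub>R F y) v = g x *\<^sub>R differential F v + v g *\<^sub>R F x"
  using assms by (simp add: differential_def vec_eq_iff tangent_mult smooth_map_nth)

end

end

section \<open>The orthotomic\<close>

text \<open>In the squared norm the terms \<open>4 * (a \<bullet> u)\<^sup>2\<close> and
  \<open>- 4 * (a \<bullet> u)\<^sup>2\<close> cancel because
  \<open>u \<bullet> u = 1\<close>.\<close>

lemma norm_reflection:
  fixes a u :: "'a::real_inner"
  assumes "norm u = 1"
  shows "norm ((2 * (a \<bullet> u)) *\<^sub>R u - a) = norm a"
proof -
  have "u \<bullet> u = 1" using assms by (simp add: dot_square_norm)
  then show ?thesis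
    by (simp add: norm_eq_sqrt_inner inner_diff inner_commute algebra_simps)
qed

theorem proposition1:
  fixes N :: "'p topology"
    and A :: "('p set \<times> ('p \<Rightarrow> real ^ 'n)) set"
    and ft nut f nu :: "'p \<Rightarrow> real ^ 'm"
    and P :: "real ^ 'm"
  assumes "CARD('m) = CARD('n) + 1"
    and "smooth_manifold N A"
    and "frontal N A ft nut"
    and "\<forall>x\<in>topspace N. (ft x - P) \<bullet> nut x \<noteq> 0"
    and "f = orthotomic P ft nut"
    and "nu = (\<lambda>x. (f x - ft x) /\<^sub>R norm (f x - ft x))"
  shows "frontal N A f nu \<and> (\<forall>x\<in>topspace N. (f x - P) \<bullet> nu x \<noteq> 0)"
proof -
  note M = assms(2)
  define g where "g x = ft x - P" for x
  define h where "h x = 2 * (g x \<bullet> nut x)" for x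
  have ft: "smooth_map A ft" and nut: "smooth_map A nut"
    and unit: "\<And>x. x \<in> topspace N \<Longrightarrow> norm (nut x) = 1"
    and orth: "\<And>x v. x \<in> topspace N \<Longrightarrow> v \<in> tangent_space A x \<Longrightarrow> differential ft v \<bullet> nut x = 0"
    using assms(3) by (auto simp: frontal_def)
  have f: "f = (\<lambda>x. h x *\<^sub>R nut x + P)"
    using assms(5) by (auto simp: orthotomic_def g_def h_def)
  have w: "f x - ft x = h x *\<^sub>R nut x - g x" for x
    by (simp add: f g_def)
  have g: "smooth_map A g"
    unfolding g_def by (intro smooth_map_diff[OF M] ft smooth_map_const[OF M])
  have gn: "smooth_map A (\<lambda>x. g x \<bullet> nut x)"
    by (intro smooth_map_inner[OF M] g nut)
  have h: "smooth_map A h"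
    unfolding h_def by (intro smooth_map_mult[OF M] gn smooth_map_const[OF M])
  have hn: "smooth_map A (\<lambda>x. h x *\<^sub>R nut x)"
    by (intro smooth_map_scaleR[OF M] h nut)
  have fs: "smooth_map A f"
    unfolding f by (intro smooth_map_add[OF M] hn smooth_map_const[OF M])
  have h0: "h x \<noteq> 0" and w0: "f x - ft x \<noteq> 0" if "x \<in> topspace N" for x
  proof -
    show "h x \<noteq> 0" using assms(4) that by (simp add: h_def g_def)
    then have "g x \<noteq> 0" by (auto simp: h_def)
    then show "f x - ft x \<noteq> 0"
      using norm_reflection[OF unit[OF that], of "g x"] by (auto simp: w h_def)
  qed
  have nn: "nut x \<bullet> nut x = 1" if "x \<in> topspace N" for x
    using unit[OF that] by (simp add: dot_square_norm)
  have tangent: "differential f v \<bullet> (f x - ft x) = 0"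
    if x: "x \<in> topspace N" and v: "v \<in> tangent_space A x" for x v
  proof -
    note T = M x v
    \<comment> \<open>\<open>nut\<close> has unit length only on \<open>topspace N\<close>, so the
      two functions need not be equal in HOL and \<open>tangent_cong\<close> is required.\<close>
    have "v (\<lambda>y. nut y \<bullet> nut y) = v (\<lambda>y. 1)"
      by (intro tangent_cong[OF T] smooth_map_inner[OF M] nut smooth_map_const[OF M] nn)
    then have dn: "differential nut v \<bullet> nut x = 0"
      by (simp add: tangent_inner[OF T nut nut] tangent_const[OF T] inner_commute)
    have dg: "differential g v = differential ft v"
      using differential_add_const[OF T ft, of "- P"] by (simp add: g_def[abs_def])
    have "v h = 2 * v (\<lambda>y. g y \<bullet> nut y)"
      unfolding h_def[abs_def] by (rule tangent_scale[OF T gn])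
    then have dh: "v h = 2 * (g x \<bullet> differential nut v)"
      \<comment> \<open>The other Leibniz term \<open>differential ft v \<bullet> nut x\<close>
        vanishes by the frontal condition.\<close>
      using orth[OF x v] by (simp add: tangent_inner[OF T g nut] dg)
    have df: "differential f v = h x *\<^sub>R differential nut v + v h *\<^sub>R nut x"
      unfolding f by (simp add: differential_add_const[OF T hn] differential_scaleR[OF T h nut])
    have "nut x \<bullet> g x = h x / 2" by (simp add: h_def inner_commute)
    then show ?thesis
      by (simp add: w df dh dn nn[OF x] inner_add_left inner_diff_right inner_commute[of _ "g x"])
        (simp add: inner_commute algebra_simps)
  qed
  have pos: "(f x - P) \<bullet> (f x - ft x) \<noteq> 0" if "x \<in> topspace N" for x
  proof -
    have "(f x - P) \<bullet> (f x - ft x) = (h x)\<^sup>2 / 2"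
      unfolding w using nn[OF that]
      by (simp add: f inner_diff_right h_def inner_commute power2_eq_square algebra_simps)
    with h0[OF that] show ?thesis by (metis divide_eq_0_iff power_not_zero zero_neq_numeral)
  qed
  have "smooth_map A nu"
    unfolding assms(6) using w0 by (intro smooth_map_normalize[OF M] smooth_map_diff[OF M] fs ft)
  \<comment> \<open>\<open>tangent\<close> and \<open>pos\<close> concern the unnormalised vector
    \<open>f x - ft x\<close>; dividing by its nonzero norm preserves both and gives unit
    length.\<close>
  with fs tangent w0 pos show ?thesis
    by (auto simp: frontal_def assms(6))
qed

end
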